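(* Let $\mathcal{X}=\mathcal{X}_1\times\cdots\times\mathcal{X}_n$ with each $\mathcal{X}_i\subseteq\mathbb{R}^{m_i}$ closed and convex, and let $f$ be a smooth (continuously differentiable) real-valued function on $\mathcal{X}$. Let $T\ge1$ be an integer and let $\{\vartheta^r\}_{r\ge1}$ be nonempty subsets of $\{1,\dots,n\}$ with $\bigcup_{i=1}^T\vartheta^{r+i}=\{1,\dots,n\}$ for all $r\ge0$ (overlapping essentially cyclic rule with period $T$). For each $\vartheta\in\{\vartheta^r:r\ge1\}$ let $\mathcal{X}_\vartheta=\prod_{i\in\vartheta}\mathcal{X}_i$ and let $h_\vartheta:\mathcal{X}_\vartheta\times\mathcal{X}\to\mathbb{R}$ be continuous, with $h_\vartheta(\cdot,x)$ strictly convex for every $x\in\mathcal{X}$, and $$h_\vartheta'(y_\vartheta,x;d_\vartheta)\big|_{y_\vartheta=x_\vartheta}=f'(x;d)$$ for all $x\in\mathcal{X}$ and all $d$ whose blocks outside $\vartheta$ vanish and with $x_\vartheta+d_\vartheta\in\mathcal{X}_\vartheta$ (directional derivative of $h_\vartheta$ in its first variable). Let $\{x^r\}_{r\ge0}\subseteq\mathcal{X}$ be any sequence generated by the BSCA algorithm with this update rule (defined in the context) with parameters $\sigma,\beta\in(0,1)$ and $\alpha^{\rm init}>0$. Then every limit point of $\{x^r\}$ is a stationary point of $\min_{x\in\mathcal{X}}f(x)$.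
   Context: Directional derivative: $g'(x;d):=\liminf_{\lambda\downarrow0}\frac{g(x+\lambda d)-g(x)}{\lambda}$ for $g$ on a convex set containing $x$ and $x+d$. Vectors are written in blocks $x=(x_1,\dots,x_n)$, $x_k\in\mathbb{R}^{m_k}$, and $x_\vartheta=(x_i)_{i\in\vartheta}$. A point $z\in\mathcal{X}$ is stationary if $f'(z;d)\ge0$ for all $d$ with $z+d\in\mathcal{X}$. A limit point of a sequence is the limit of some convergent subsequence. BSCA algorithm with block schedule $\{\vartheta^r\}$: fix $\sigma,\beta\in(0,1)$, $\alpha^{\rm init}>0$ and $x^0\in\mathcal{X}$. For $r=1,2,\dots$: with $\vartheta=\vartheta^r$, let $y_\vartheta^r\in\arg\min_{x_\vartheta\in\mathcal{X}_\vartheta}h_\vartheta(x_\vartheta,x^{r-1})$ (assumed to exist) and $y_k^r=x_k^{r-1}$ for $k\notin\vartheta$; set $d^r=y^r-x^{r-1}$; (Armijo rule) let $\alpha^r$ be the largest element $\alpha$ of $\{\alpha^{\rm init}\beta^j\}_{j=0,1,2,\dots}$ such that $x^{r-1}+\alpha d^r\in\mathcal{X}$ and $f(x^{r-1})-f(x^{r-1}+\alpha d^r)\ge-\sigma\alpha f'(x^{r-1};d^r)$; set $x^r=x^{r-1}+\alpha^r d^r$. *)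

theory Defs
  imports "HOL-Analysis.Analysis"
begin

text \<open>
  Block vectors: a point of \<open>R^(m_1) \<times> ... \<times> R^(m_n)\<close> is an element \<open>x\<close> of \<open>real ^ 'N\<close> together
  with a map \<open>blk :: 'N \<Rightarrow> nat\<close> with values in \<open>{1..n}\<close>, where \<open>blk c\<close> is the index of the block
  containing the coordinate \<open>c\<close>; thus \<open>m_k\<close> is the number of coordinates \<open>c\<close> with \<open>blk c = k\<close>.
  For a set \<open>S\<close> of block indices, the product of the \<open>R^(m_i)\<close> with \<open>i \<in> S\<close> is identified with
  the vectors of \<open>real ^ 'N\<close> whose blocks outside \<open>S\<close> vanish; \<open>S = {i}\<close> gives \<open>R^(m_i)\<close>.
\<close>

definition block_space :: "('N::finite \<Rightarrow> nat) \<Rightarrow> nat set \<Rightarrow> (real ^ 'N) set" where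
  "block_space blk S = {v. \<forall>c. blk c \<notin> S \<longrightarrow> v $ c = 0}"

definition block_restrict :: "('N::finite \<Rightarrow> nat) \<Rightarrow> nat set \<Rightarrow> real ^ 'N \<Rightarrow> real ^ 'N" where
  "block_restrict blk S x = (\<chi> c. if blk c \<in> S then x $ c else 0)"

definition block_prod ::
  "('N::finite \<Rightarrow> nat) \<Rightarrow> (nat \<Rightarrow> (real ^ 'N) set) \<Rightarrow> nat set \<Rightarrow> (real ^ 'N) set" where
  "block_prod blk Xs S = {v \<in> block_space blk S. \<forall>i\<in>S. block_restrict blk {i} v \<in> Xs i}"

text \<open>
  The directional derivative is a lower limit, so it is extended-real valued. For \<open>g\<close> of interest
  on a convex set containing \<open>x\<close> and \<open>x + d\<close>, only values of \<open>g\<close> on that set matter, because the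
  limit only involves arbitrarily small \<open>t > 0\<close>.
\<close>

definition dir_deriv :: "('a::real_normed_vector \<Rightarrow> real) \<Rightarrow> 'a \<Rightarrow> 'a \<Rightarrow> ereal" where
  "dir_deriv g x d = Liminf (at_right 0) (\<lambda>t. ereal ((g (x + t *\<^sub>R d) - g x) / t))"

definition strictly_convex_on :: "'a::real_vector set \<Rightarrow> ('a \<Rightarrow> real) \<Rightarrow> bool" where
  "strictly_convex_on S g \<longleftrightarrow> convex S \<and>
     (\<forall>x\<in>S. \<forall>y\<in>S. \<forall>t. x \<noteq> y \<and> 0 < t \<and> t < 1 \<longrightarrow>
        g ((1 - t) *\<^sub>R x + t *\<^sub>R y) < (1 - t) * g x + t * g y)"

text \<open>
  Continuous differentiability relative to \<open>S\<close>, which may have empty interior: a gradient within \<open>S\<close>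
  exists at each point of \<open>S\<close> and can be chosen continuously. Restrictions to \<open>S\<close> of functions that
  are continuously differentiable on an open superset of \<open>S\<close> satisfy this.
\<close>

definition C1_on :: "'a::euclidean_space set \<Rightarrow> ('a \<Rightarrow> real) \<Rightarrow> bool" where
  "C1_on S g \<longleftrightarrow> (\<exists>G :: 'a \<Rightarrow> 'a. continuous_on S G \<and>
     (\<forall>x\<in>S. (g has_derivative (\<lambda>v. G x \<bullet> v)) (at x within S)))"

definition stationary :: "('a::real_normed_vector \<Rightarrow> real) \<Rightarrow> 'a set \<Rightarrow> 'a \<Rightarrow> bool" where
  "stationary f X z \<longleftrightarrow> z \<in> X \<and> (\<forall>d. z + d \<in> X \<longrightarrow> dir_deriv f z d \<ge> 0)"

definition limit_point_of :: "(nat \<Rightarrow> 'a::topological_space) \<Rightarrow> 'a \<Rightarrow> bool" where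
  "limit_point_of x z \<longleftrightarrow> (\<exists>s :: nat \<Rightarrow> nat. strict_mono s \<and> (x \<circ> s) \<longlonglongrightarrow> z)"

definition essentially_cyclic :: "nat \<Rightarrow> nat \<Rightarrow> (nat \<Rightarrow> nat set) \<Rightarrow> bool" where
  "essentially_cyclic n T \<theta> \<longleftrightarrow>
     (\<forall>r\<ge>1. \<theta> r \<noteq> {} \<and> \<theta> r \<subseteq> {1..n}) \<and> (\<forall>r. (\<Union>i\<in>{1..T}. \<theta> (r + i)) = {1..n})"

definition armijo_step ::
  "('a::real_normed_vector \<Rightarrow> real) \<Rightarrow> 'a set \<Rightarrow> real \<Rightarrow> real \<Rightarrow> real \<Rightarrow> 'a \<Rightarrow> 'a \<Rightarrow> real \<Rightarrow> bool" where
  "armijo_step f X \<sigma> \<beta> \<alpha>init x d \<alpha> \<longleftrightarrow>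
     (let A = {a \<in> range (\<lambda>j::nat. \<alpha>init * \<beta> ^ j). x + a *\<^sub>R d \<in> X \<and>
                 ereal (f x - f (x + a *\<^sub>R d)) \<ge> - (ereal (\<sigma> * a) * dir_deriv f x d)}
      in \<alpha> \<in> A \<and> (\<forall>a\<in>A. a \<le> \<alpha>))"

definition bsca_sequence ::
  "('N::finite \<Rightarrow> nat) \<Rightarrow> nat \<Rightarrow> (nat \<Rightarrow> (real ^ 'N) set) \<Rightarrow> (real ^ 'N \<Rightarrow> real) \<Rightarrow>
   (nat set \<Rightarrow> real ^ 'N \<Rightarrow> real ^ 'N \<Rightarrow> real) \<Rightarrow> (nat \<Rightarrow> nat set) \<Rightarrow>
   real \<Rightarrow> real \<Rightarrow> real \<Rightarrow> (nat \<Rightarrow> real ^ 'N) \<Rightarrow> bool" where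
  "bsca_sequence blk n Xs f h \<theta> \<sigma> \<beta> \<alpha>init x \<longleftrightarrow>
     x 0 \<in> block_prod blk Xs {1..n} \<and>
     (\<forall>r\<ge>1. \<exists>y \<alpha>.
        is_arg_min (\<lambda>v. h (\<theta> r) v (x (r - 1))) (\<lambda>v. v \<in> block_prod blk Xs (\<theta> r))
          (block_restrict blk (\<theta> r) y) \<and>
        (\<forall>c. blk c \<notin> \<theta> r \<longrightarrow> y $ c = x (r - 1) $ c) \<and>
        armijo_step f (block_prod blk Xs {1..n}) \<sigma> \<beta> \<alpha>init (x (r - 1)) (y - x (r - 1)) \<alpha> \<and>
        x r = x (r - 1) + \<alpha> *\<^sub>R (y - x (r - 1)))"

end

theory Submission
  imports Defs
begin

text \<open>
  Let \<open>x(s j) \<rightarrow> z\<close>. The directions \<open>d(s j)\<close> tend to \<open>0\<close>: otherwise, along a subsequence with a fixed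
  block set \<open>S\<close>, the normalised directions converge to some \<open>p\<close>, and \<open>\<parallel>d\<parallel> \<ge> \<delta>\<close>. Since \<open>h\<^sub>S\<close> does not
  increase along \<open>d\<close>, it does not increase from \<open>z\<^sub>S\<close> to \<open>z\<^sub>S + \<delta> p\<close> in the limit, and strict convexity makes
  \<open>p\<close> a descent direction of \<open>f\<close> at \<open>z\<close>; but the Armijo rule forces step lengths to vanish along
  such directions, and the mean value theorem applied to the last rejected step contradicts \<open>\<sigma> < 1\<close>.
  Working with normalised directions is essential because \<open>h\<^sub>S(\<cdot>, z)\<close> need not have a minimiser.
  Hence \<open>x(s j + i) \<rightarrow> z\<close> for every fixed \<open>i\<close>. Within any \<open>T\<close> steps each block \<open>k\<close> occurs in some
  \<open>S\<close> used infinitely often, for which \<open>z\<^sub>S\<close> minimises \<open>h\<^sub>S(\<cdot>, z)\<close> in the limit, so the derivative of \<open>f\<close> at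
  \<open>z\<close> along the block-\<open>k\<close> part of any feasible direction is nonnegative. As \<open>f\<close> is smooth, the
  derivative is linear, and summing over the blocks gives stationarity.
\<close>

section \<open>Coordinate blocks, projections and block products\<close>

lemma block_restrict_nth [simp]:
  "block_restrict blk S x $ c = (if blk c \<in> S then x $ c else 0)"
  by (simp add: block_restrict_def)

lemma block_restrict_id: "v \<in> block_space blk S \<Longrightarrow> block_restrict blk S v = v"
  by (auto simp: vec_eq_iff block_space_def)

lemma block_restrict_in_space [simp]: "block_restrict blk S x \<in> block_space blk S"
  by (simp add: block_space_def)

lemma linear_block_restrict: "linear (block_restrict blk S)"
  by (rule linearI) (auto simp: vec_eq_iff)

lemmas block_restrict_add = linear_add [OF linear_block_restrict]
lemmas block_restrict_diff = linear_diff [OF linear_block_restrict]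

lemma continuous_on_block_restrict: "continuous_on A (block_restrict blk S)"
  by (rule linear_continuous_on) (rule linear_conv_bounded_linear [THEN iffD1, OF linear_block_restrict])

lemma tendsto_block_restrict:
  "(g \<longlongrightarrow> l) F \<Longrightarrow> ((\<lambda>j. block_restrict blk S (g j)) \<longlongrightarrow> block_restrict blk S l) F"
  by (rule bounded_linear.tendsto [OF linear_conv_bounded_linear [THEN iffD1, OF linear_block_restrict]])

text \<open>Presents the product as a subspace cut by preimages of the factors under linear maps, so
  closedness and convexity carry over from the factors.\<close>

lemma block_prod_eq:
  "block_prod blk Xs S = block_space blk S \<inter> (\<Inter>i\<in>S. block_restrict blk {i} -` Xs i)"
  by (auto simp: block_prod_def)

lemma block_space_eq: "block_space blk S = {v. block_restrict blk S v = v}"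
  by (auto simp: block_space_def vec_eq_iff)

lemma closed_block_prod:
  assumes "\<And>i. i \<in> S \<Longrightarrow> closed (Xs i)"
  shows "closed (block_prod blk Xs S)"
proof -
  have "closed (block_space blk S)"
    unfolding block_space_eq
    by (intro closed_Collect_eq continuous_on_block_restrict continuous_on_id)
  then show ?thesis
    unfolding block_prod_eq
    by (intro closed_Int closed_INT ballI closed_vimage continuous_on_block_restrict assms)
qed

lemma convex_block_prod:
  assumes "\<And>i. i \<in> S \<Longrightarrow> convex (Xs i)"
  shows "convex (block_prod blk Xs S)"
proof -
  have "convex (block_space blk S)"
    by (auto simp: convex_def block_space_def)
  then show ?thesis
    unfolding block_prod_eq
    by (intro convex_Int convex_INT convex_linear_vimage linear_block_restrict assms)
qed

lemma block_restrict_in_prod: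
  assumes "x \<in> block_prod blk Xs R" "S \<subseteq> R"
  shows "block_restrict blk S x \<in> block_prod blk Xs S"
proof -
  have "block_restrict blk {i} (block_restrict blk S x) = block_restrict blk {i} x" if "i \<in> S" for i
    using that by (auto simp: vec_eq_iff)
  then show ?thesis
    using assms by (auto simp: block_prod_def)
qed

text \<open>Each block of \<open>y\<close> is either one of the new blocks or copied from
  \<open>x\<close>. This makes a block update feasible for the full product.\<close>

lemma block_prod_replace:
  assumes "x \<in> block_prod blk Xs R" "block_restrict blk S y \<in> block_prod blk Xs S" "S \<subseteq> R"
    and "\<And>c. blk c \<notin> S \<Longrightarrow> y $ c = x $ c"
  shows "y \<in> block_prod blk Xs R"
proof -
  have "block_restrict blk {i} y \<in> Xs i" if "i \<in> R" for i
  proof (cases "i \<in> S")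
    case True
    then have "block_restrict blk {i} (block_restrict blk S y) = block_restrict blk {i} y"
      by (auto simp: vec_eq_iff)
    then show ?thesis
      using assms(2) True by (auto simp: block_prod_def)
  next
    case False
    then have "block_restrict blk {i} y = block_restrict blk {i} x"
      using assms(4) by (auto simp: vec_eq_iff)
    then show ?thesis
      using assms(1) that by (auto simp: block_prod_def)
  qed
  moreover have "y \<in> block_space blk R"
    using assms(1,3,4) unfolding block_prod_def block_space_def by (smt (verit) mem_Collect_eq subsetD)
  ultimately show ?thesis
    by (simp add: block_prod_def)
qed

lemma sum_block_restrict:
  assumes "range blk \<subseteq> R" "finite R"
  shows "(\<Sum>k\<in>R. block_restrict blk {k} d) = d"
proof -
  have "(\<Sum>k\<in>R. block_restrict blk {k} d $ c) = (\<Sum>k\<in>R. if blk c = k then d $ c else 0)" for c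
    by (intro sum.cong) auto
  moreover have "blk c \<in> R" for c
    using assms(1) by auto
  ultimately show ?thesis
    using assms(2) by (auto simp: vec_eq_iff)
qed

section \<open>Differentiation along feasible segments\<close>

lemma convex_mem_segment:
  assumes "convex S" "v \<in> S" "v + d \<in> S" "0 \<le> t" "t \<le> 1"
  shows "v + t *\<^sub>R d \<in> S"
proof -
  have "(1 - t) *\<^sub>R v + t *\<^sub>R (v + d) \<in> S"
    using assms by (intro convexD_alt)
  then show ?thesis
    by (simp add: algebra_simps)
qed

text \<open>The gradient is only relative to \<open>X\<close>, so the chain rule needs the whole
  segment inside \<open>X\<close>; convexity provides this after rescaling by \<open>b\<close>,
  which is why \<open>b = 0\<close> is treated separately.\<close>

lemma has_derivative_along_segment:
  assumes "convex X" "w \<in> X" "w + b *\<^sub>R d \<in> X" "t \<in> {0..b}"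
    and "\<And>x. x \<in> X \<Longrightarrow> (f has_derivative (\<lambda>v. G x \<bullet> v)) (at x within X)"
  shows "w + t *\<^sub>R d \<in> X"
    and "((\<lambda>u. f (w + u *\<^sub>R d)) has_derivative (\<lambda>u. u * (G (w + t *\<^sub>R d) \<bullet> d)))
           (at t within {0..b})"
proof -
  have mem: "w + u *\<^sub>R d \<in> X" if "u \<in> {0..b}" for u
  proof (cases "b = 0")
    case False
    then have "w + (u / b) *\<^sub>R (b *\<^sub>R d) \<in> X"
      using that assms(1-3) by (intro convex_mem_segment [where d = "b *\<^sub>R d"]) auto
    then show ?thesis
      using False by simp
  qed (use that assms in auto)
  show "w + t *\<^sub>R d \<in> X"
    using mem assms(4) .
  have "((\<lambda>u. f (w + u *\<^sub>R d)) has_derivative (\<lambda>u. G (w + t *\<^sub>R d) \<bullet> (u *\<^sub>R d)))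
           (at t within {0..b})"
  proof (rule has_derivative_in_compose2 [where t = X and g = f])
    show "\<And>x. x \<in> X \<Longrightarrow> (f has_derivative (\<lambda>v. G x \<bullet> v)) (at x within X)"
      by fact
    show "(\<lambda>u. w + u *\<^sub>R d) ` {0..b} \<subseteq> X"
      using mem by auto
    show "((\<lambda>u. w + u *\<^sub>R d) has_derivative (\<lambda>u. u *\<^sub>R d)) (at t within {0..b})"
      by (auto intro!: derivative_eq_intros)
  qed (use assms in auto)
  then show "((\<lambda>u. f (w + u *\<^sub>R d)) has_derivative (\<lambda>u. u * (G (w + t *\<^sub>R d) \<bullet> d)))
           (at t within {0..b})"
    by simp
qed

lemma mean_value_along_segment:
  assumes "convex X" "w \<in> X" "w + b *\<^sub>R d \<in> X" "0 \<le> b"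
    and "\<And>x. x \<in> X \<Longrightarrow> (f has_derivative (\<lambda>v. G x \<bullet> v)) (at x within X)"
  obtains u where "u \<in> {0..b}" "w + u *\<^sub>R d \<in> X"
    "f (w + b *\<^sub>R d) - f w = b * (G (w + u *\<^sub>R d) \<bullet> d)"
proof -
  obtain u where u: "u \<in> {0..b}"
      "f (w + b *\<^sub>R d) - f (w + 0 *\<^sub>R d) = (b - 0) * (G (w + u *\<^sub>R d) \<bullet> d)"
    using mvt_very_simple [of 0 b "\<lambda>u. f (w + u *\<^sub>R d)" "\<lambda>t u. u * (G (w + t *\<^sub>R d) \<bullet> d)"]
      has_derivative_along_segment(2) [OF assms(1-3) _ assms(5)] assms(4) by auto
  then show ?thesis
    using that has_derivative_along_segment(1) [OF assms(1-3) u(1) assms(5)] by simp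
qed

text \<open>The difference quotients have a true one-sided limit, with which the lower limit
  coincides. This makes the derivative of \<open>f\<close> finite and linear in
  \<open>d\<close>.\<close>

lemma dir_deriv_eq_inner:
  assumes "convex X" "w \<in> X" "w + d \<in> X"
    and "\<And>x. x \<in> X \<Longrightarrow> (f has_derivative (\<lambda>v. G x \<bullet> v)) (at x within X)"
  shows "dir_deriv f w d = ereal (G w \<bullet> d)"
proof -
  have "((\<lambda>u. f (w + u *\<^sub>R d)) has_derivative (\<lambda>u. u * (G (w + 0 *\<^sub>R d) \<bullet> d)))
           (at 0 within {0..1})"
    using assms by (intro has_derivative_along_segment(2) [where X = X]) auto
  then have "((\<lambda>u. f (w + u *\<^sub>R d)) has_field_derivative (G w \<bullet> d)) (at 0 within {0..1})"
    unfolding has_field_derivative_def by (simp add: mult_commute_abs)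
  then have "((\<lambda>t. (f (w + t *\<^sub>R d) - f w) / t) \<longlongrightarrow> G w \<bullet> d) (at 0 within {0..1})"
    unfolding has_field_derivative_iff by simp
  then have "((\<lambda>t. (f (w + t *\<^sub>R d) - f w) / t) \<longlongrightarrow> G w \<bullet> d) (at_right 0)"
    by (simp add: at_within_Icc_at_right)
  then show ?thesis
    unfolding dir_deriv_def by (intro lim_imp_Liminf) auto
qed

section \<open>Directional derivatives of strictly convex functions\<close>

lemma strictly_convex_onD:
  assumes "strictly_convex_on S g" "a \<in> S" "b \<in> S" "a \<noteq> b" "0 < t" "t < 1"
  shows "g ((1 - t) *\<^sub>R a + t *\<^sub>R b) < (1 - t) * g a + t * g b"
  using assms unfolding strictly_convex_on_def by blast

text \<open>Strict convexity puts the midpoint value strictly below \<open>g v\<close>, even if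
  \<open>g (v + d) = g v\<close>. The slope from \<open>v\<close> to the midpoint is then a negative
  bound on all quotients with \<open>t < 1/2\<close>, so the lower limit stays strictly
  negative.\<close>

lemma dir_deriv_neg:
  assumes "strictly_convex_on S g" "v \<in> S" "v + d \<in> S" "d \<noteq> 0" "g (v + d) \<le> g v"
  shows "dir_deriv g v d < 0"
proof -
  define m where "m = v + (1/2) *\<^sub>R d"
  note conv = strictly_convex_onD [OF assms(1)]
  have "m \<in> S"
    unfolding m_def using assms by (intro convex_mem_segment) (auto simp: strictly_convex_on_def)
  have m: "(1 - 1/2) *\<^sub>R v + (1/2) *\<^sub>R (v + d) = m"
    by (simp add: m_def algebra_simps flip: scaleR_left_distrib)
  have "g m < g v"
    using conv [of v "v + d" "1/2"] assms unfolding m by auto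
  have "(g (v + t *\<^sub>R d) - g v) / t \<le> 2 * (g m - g v)" if "0 < t" "t < 1/2" for t
  proof -
    have "(1 - 2 * t) *\<^sub>R v + (2 * t) *\<^sub>R m = v + t *\<^sub>R d"
      by (simp add: m_def algebra_simps)
    then have "g (v + t *\<^sub>R d) < (1 - 2 * t) * g v + 2 * t * g m"
      using conv [of v m "2 * t"] that \<open>m \<in> S\<close> \<open>g m < g v\<close> assms by auto
    then show ?thesis
      using that by (simp add: field_simps)
  qed
  then have "\<forall>\<^sub>F t in at_right 0. ereal ((g (v + t *\<^sub>R d) - g v) / t) \<le> ereal (2 * (g m - g v))"
    unfolding eventually_at_right_field by (intro exI [of _ "1/2"]) auto
  then have "dir_deriv g v d \<le> ereal (2 * (g m - g v))"
    unfolding dir_deriv_def by (rule Liminf_le [rotated]) simp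
  also have "\<dots> < 0"
    using \<open>g m < g v\<close> by simp
  finally show ?thesis .
qed

lemma dir_deriv_nonneg_at_min:
  assumes "\<And>t. 0 < t \<Longrightarrow> t < 1 \<Longrightarrow> g v \<le> g (v + t *\<^sub>R d)"
  shows "0 \<le> dir_deriv g v d"
  unfolding dir_deriv_def
proof (rule Liminf_bounded)
  show "\<forall>\<^sub>F t in at_right 0. 0 \<le> ereal ((g (v + t *\<^sub>R d) - g v) / t)"
    unfolding eventually_at_right_field using assms by (intro exI [of _ 1]) auto
qed

text \<open>The vectors \<open>e j\<close> may be unbounded, so each is shortened to length
  \<delta>. Convexity keeps the value at the shortened point at most that at \<open>v j\<close>, and
  joint continuity passes this to the limit.\<close>

lemma dir_deriv_limit_neg:
  fixes g :: "'a::real_normed_vector \<Rightarrow> 'b::topological_space \<Rightarrow> real"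
  assumes "closed S" and cont: "continuous_on (S \<times> X) (\<lambda>(v, w). g v w)"
    and conv: "\<And>w. w \<in> X \<Longrightarrow> strictly_convex_on S (\<lambda>v. g v w)"
    and w: "\<And>j::nat. w j \<in> X" "w \<longlonglongrightarrow> z" "z \<in> X"
    and v: "\<And>j. v j \<in> S" "v \<longlonglongrightarrow> l"
    and e: "\<And>j. v j + e j \<in> S" "\<And>j. g (v j + e j) (w j) \<le> g (v j) (w j)"
    and \<delta>: "0 < \<delta>" "\<And>j. \<delta> \<le> norm (e j)"
    and p: "(\<lambda>j. e j /\<^sub>R norm (e j)) \<longlonglongrightarrow> p"
  shows "l + \<delta> *\<^sub>R p \<in> S" "dir_deriv (\<lambda>v. g v z) l (\<delta> *\<^sub>R p) < 0"
proof -
  define u where "u j = v j + \<delta> *\<^sub>R (e j /\<^sub>R norm (e j))" for j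
  have pos: "0 < norm (e j)" for j
    using \<delta>(1) \<delta>(2) [of j] by linarith
  have u_eq: "u j = v j + (\<delta> / norm (e j)) *\<^sub>R e j" for j
    by (simp add: u_def field_simps)
  have t: "0 < \<delta> / norm (e j)" "\<delta> / norm (e j) \<le> 1" for j
    using \<delta> pos [of j] by auto
  have convS: "convex S"
    using conv w(1) by (auto simp: strictly_convex_on_def)
  have uS: "u j \<in> S" for j
    unfolding u_eq using convS v(1) e(1) t by (intro convex_mem_segment) (auto intro: less_imp_le)
  have u_lim: "u \<longlonglongrightarrow> l + \<delta> *\<^sub>R p"
    unfolding u_def by (intro tendsto_intros v p)
  then show mem: "l + \<delta> *\<^sub>R p \<in> S"
    using \<open>closed S\<close> uS closed_sequentially by blast
  have l: "l \<in> S"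
    using \<open>closed S\<close> v closed_sequentially by blast
  have g_le: "g (u j) (w j) \<le> g (v j) (w j)" for j
  \<comment> \<open>Strict convexity only speaks of interior points; at ratio 1 the shortened point
    is \<open>v j + e j\<close> itself.\<close>
  proof (cases "\<delta> / norm (e j) = 1")
    case True
    then show ?thesis using e(2) unfolding u_eq by simp
  next
    case False
    define t where "t = \<delta> / norm (e j)"
    have t01: "0 < t" "t < 1"
      using t [of j] False unfolding t_def by linarith+
    have "e j \<noteq> 0" using pos [of j] by auto
    then have "g ((1 - t) *\<^sub>R v j + t *\<^sub>R (v j + e j)) (w j)
        < (1 - t) * g (v j) (w j) + t * g (v j + e j) (w j)"
      using strictly_convex_onD [OF conv [OF w(1)] v(1) e(1) _ t01] by simp
    also have "(1 - t) *\<^sub>R v j + t *\<^sub>R (v j + e j) = u j"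
      unfolding u_eq t_def [symmetric] by (simp add: algebra_simps)
    also have "(1 - t) * g (v j) (w j) + t * g (v j + e j) (w j) \<le> g (v j) (w j)"
      using mult_left_mono [OF e(2) [of j], of t] t01 by (simp add: algebra_simps)
    finally show ?thesis by simp
  qed
  have lim: "(\<lambda>j. g (a j) (w j)) \<longlonglongrightarrow> g a0 z" if "a \<longlonglongrightarrow> a0" "a0 \<in> S" "\<And>j. a j \<in> S" for a a0
    using continuous_on_tendsto_compose [OF cont, of "\<lambda>j. (a j, w j)" "(a0, z)" sequentially]
      tendsto_Pair [OF that(1) w(2)] that w by auto
  have "g (l + \<delta> *\<^sub>R p) z \<le> g l z"
    using LIMSEQ_le [OF lim [OF u_lim mem uS] lim [OF v(2) l v(1)]] g_le by auto
  \<comment> \<open>Ensures that the limit direction \<open>\<delta> *\<^sub>R p\<close> is nonzero,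
    without which strict convexity says nothing.\<close>
  moreover have "norm p = 1"
  proof -
    have "(\<lambda>j. norm (e j /\<^sub>R norm (e j))) \<longlonglongrightarrow> norm p"
      using p by (intro tendsto_norm)
    moreover have "norm (e j /\<^sub>R norm (e j)) = 1" for j
      using pos [of j] by simp
    ultimately show ?thesis
      by (simp add: LIMSEQ_const_iff)
  qed
  ultimately show "dir_deriv (\<lambda>v. g v z) l (\<delta> *\<^sub>R p) < 0"
    using \<delta>(1) by (intro dir_deriv_neg [OF conv [OF w(3)] l mem]) auto
qed

section \<open>The Armijo rule along a limit direction\<close>

text \<open>Finiteness of the directional derivative turns the extended-real test into real
  inequalities. The last claim is maximality: a larger feasible trial step must have failed the
  decrease test.\<close>

lemma armijo_stepD:
  assumes "armijo_step f X \<sigma> \<beta> \<alpha>init w d a" "dir_deriv f w d = ereal D"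
  shows "\<exists>m::nat. a = \<alpha>init * \<beta> ^ m" "w + a *\<^sub>R d \<in> X"
    "- (\<sigma> * a * D) \<le> f w - f (w + a *\<^sub>R d)"
    "\<And>m. \<lbrakk>a < \<alpha>init * \<beta> ^ m; w + (\<alpha>init * \<beta> ^ m) *\<^sub>R d \<in> X\<rbrakk>
       \<Longrightarrow> f w - f (w + (\<alpha>init * \<beta> ^ m) *\<^sub>R d) < - (\<sigma> * (\<alpha>init * \<beta> ^ m) * D)"
proof -
  define P where "P = (\<lambda>b. b \<in> range (\<lambda>j::nat. \<alpha>init * \<beta> ^ j) \<and> w + b *\<^sub>R d \<in> X
    \<and> - (\<sigma> * b * D) \<le> f w - f (w + b *\<^sub>R d))"
  have "P a" and max: "\<And>b. P b \<Longrightarrow> b \<le> a"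
    using assms(1) unfolding armijo_step_def Let_def assms(2) P_def by simp_all
  then show "\<exists>m::nat. a = \<alpha>init * \<beta> ^ m" "w + a *\<^sub>R d \<in> X"
    "- (\<sigma> * a * D) \<le> f w - f (w + a *\<^sub>R d)"
    unfolding P_def by blast+
  fix m
  assume m: "a < \<alpha>init * \<beta> ^ m" "w + (\<alpha>init * \<beta> ^ m) *\<^sub>R d \<in> X"
  then have "\<not> P (\<alpha>init * \<beta> ^ m)"
    using max by fastforce
  then show "f w - f (w + (\<alpha>init * \<beta> ^ m) *\<^sub>R d) < - (\<sigma> * (\<alpha>init * \<beta> ^ m) * D)"
    using m(2) unfolding P_def by (meson not_le rangeI)
qed

text \<open>If \<open>p\<close> were a descent direction, vanishing decreases would force the
  displacements \<open>a j * norm (d j)\<close> to 0. The rejected trial points then also tend to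
  \<open>z\<close>, and their failed tests give
  \<open>\<sigma> * (G z \<bullet> p) \<le> G z \<bullet> p\<close> in the limit, impossible for a
  negative slope. All slopes are taken along normalised directions because \<open>d\<close> may be
  unbounded.\<close>

lemma armijo_limit_direction:
  fixes f :: "'a::euclidean_space \<Rightarrow> real"
  assumes X: "convex X" and cont: "continuous_on X G"
    and deriv: "\<And>x. x \<in> X \<Longrightarrow> (f has_derivative (\<lambda>v. G x \<bullet> v)) (at x within X)"
    and par: "0 < \<sigma>" "\<sigma> < 1" "0 < \<beta>" "\<beta> < 1" "0 < \<alpha>init"
    and w: "\<And>j::nat. w j \<in> X" "w \<longlonglongrightarrow> z" "z \<in> X"
    and d: "\<And>j. w j + d j \<in> X"
    and armijo: "\<And>j. armijo_step f X \<sigma> \<beta> \<alpha>init (w j) (d j) (a j)"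
    and decr: "(\<lambda>j. f (w j) - f (w j + a j *\<^sub>R d j)) \<longlonglongrightarrow> 0"
    and \<delta>: "0 < \<delta>" "\<And>j. \<delta> \<le> norm (d j)"
    and p: "(\<lambda>j. d j /\<^sub>R norm (d j)) \<longlonglongrightarrow> p"
  shows "0 \<le> G z \<bullet> p"
proof (rule ccontr)
  assume "\<not> 0 \<le> G z \<bullet> p"
  then have neg: "G z \<bullet> p < 0" by simp
  define N where "N j = norm (d j)" for j
  define q where "q j = d j /\<^sub>R norm (d j)" for j
  \<comment> \<open>Half the limiting slope: a fixed negative number that eventually bounds the
    slopes \<open>G (w j) \<bullet> q j\<close> from above.\<close>
  define c where "c = G z \<bullet> p / 2"
  have c: "c < 0" "G z \<bullet> p < c" using neg by (auto simp: c_def)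
  have N: "0 < N j" "\<delta> \<le> N j" for j
    using \<delta>(1) \<delta>(2) [of j] unfolding N_def by linarith+
  have dq: "d j = N j *\<^sub>R q j" for j
    using N(1) [of j] by (simp add: q_def N_def)
  have q: "q \<longlonglongrightarrow> p"
    using p by (simp add: q_def [abs_def])
  note A = armijo_stepD [OF armijo dir_deriv_eq_inner [OF X w(1) d deriv]]
  have a_pos: "0 < a j" for j
    using A(1) [of j] par by auto
  have g: "(\<lambda>j. G (w j) \<bullet> q j) \<longlonglongrightarrow> G z \<bullet> p"
    by (intro tendsto_inner q continuous_on_tendsto_compose [OF cont] w always_eventually allI)
  have "\<forall>\<^sub>F j in sequentially. G (w j) \<bullet> q j < c"
    using order_tendstoD(2) [OF g c(2)] .
  then have "\<forall>\<^sub>F j in sequentially. norm (a j * N j) \<le> (f (w j) - f (w j + a j *\<^sub>R d j)) / (- \<sigma> * c)"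
  proof eventually_elim
    case (elim j)
    have "- \<sigma> * c * (a j * N j) = \<sigma> * a j * N j * (- c)" by simp
    also have "\<dots> \<le> \<sigma> * a j * N j * (- (G (w j) \<bullet> q j))"
      using elim par a_pos N by (intro mult_left_mono) (auto intro: less_imp_le)
    also have "\<dots> = - (\<sigma> * a j * (G (w j) \<bullet> d j))" by (simp add: dq)
    also have "\<dots> \<le> f (w j) - f (w j + a j *\<^sub>R d j)" by (rule A(3))
    finally have "a j * N j * (- \<sigma> * c) \<le> f (w j) - f (w j + a j *\<^sub>R d j)"
      by (simp only: mult.commute)
    moreover have "0 < - \<sigma> * c"
      using par c by (simp add: mult_pos_neg)
    ultimately show ?case
      using a_pos [of j] N(1) [of j] by (simp only: pos_le_divide_eq) simp
  qed
  then have aN: "(\<lambda>j. a j * N j) \<longlonglongrightarrow> 0"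
  proof (rule Lim_null_comparison)
    have "(\<lambda>j. (f (w j) - f (w j + a j *\<^sub>R d j)) / (- \<sigma> * c)) \<longlonglongrightarrow> 0 / (- \<sigma> * c)"
      using par c by (intro tendsto_divide decr tendsto_const) simp
    then show "(\<lambda>j. (f (w j) - f (w j + a j *\<^sub>R d j)) / (- \<sigma> * c)) \<longlonglongrightarrow> 0"
      by (simp only: div_0)
  qed
  \<comment> \<open>The lower bound \<delta> on the norms turns vanishing displacements into
    vanishing step sizes.\<close>
  have a0: "a \<longlonglongrightarrow> 0"
  proof (rule Lim_null_comparison)
    show "\<forall>\<^sub>F j in sequentially. norm (a j) \<le> a j * N j / \<delta>"
      using a_pos N \<delta>(1) by (intro always_eventually allI) (simp add: field_simps less_imp_le)
    show "(\<lambda>j. a j * N j / \<delta>) \<longlonglongrightarrow> 0"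
      using tendsto_divide [OF aN tendsto_const, of \<delta>] \<delta>(1) by simp
  qed
  \<comment> \<open>mean value point on the last rejected step \<open>a j / \<beta>\<close>\<close>
  define u where "u j = (SOME u. u \<in> {0..a j / \<beta>} \<and> w j + u *\<^sub>R d j \<in> X
      \<and> \<sigma> * (G (w j) \<bullet> q j) \<le> G (w j + u *\<^sub>R d j) \<bullet> q j)" for j
  \<comment> \<open>Below \<alpha>init, the accepted step is not the first trial, so it has a
    predecessor \<open>a j / \<beta>\<close>. Below \<beta>, that predecessor is at most 1 and hence
    feasible by convexity, so it can only have failed the decrease test.\<close>
  have "\<forall>\<^sub>F j in sequentially. a j < min \<alpha>init \<beta>"
    using par by (intro order_tendstoD(2) [OF a0]) auto
  then have u: "\<forall>\<^sub>F j in sequentially. u j \<in> {0..a j / \<beta>} \<and> w j + u j *\<^sub>R d j \<in> X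
      \<and> \<sigma> * (G (w j) \<bullet> q j) \<le> G (w j + u j *\<^sub>R d j) \<bullet> q j"
  proof eventually_elim
    case (elim j)
    obtain m where m: "a j = \<alpha>init * \<beta> ^ m" using A(1) by blast
    with elim obtain k where k: "m = Suc k" by (cases m) auto
    define b where "b = \<alpha>init * \<beta> ^ k"
    have ab: "a j = \<beta> * b" by (simp add: b_def m k)
    then have b: "b = a j / \<beta>" "0 < b" "b \<le> 1" using par elim a_pos [of j] by (auto simp: field_simps b_def)
    have bX: "w j + b *\<^sub>R d j \<in> X"
      using b by (intro convex_mem_segment X w d) auto
    have lt: "a j < b" using par b(2) by (simp add: ab)
    obtain t where t: "t \<in> {0..b}" "w j + t *\<^sub>R d j \<in> X"
        "f (w j + b *\<^sub>R d j) - f (w j) = b * (G (w j + t *\<^sub>R d j) \<bullet> d j)"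
      using mean_value_along_segment [OF X w(1) bX _ deriv] b by (metis less_imp_le)
    have "f (w j) - f (w j + b *\<^sub>R d j) < - (\<sigma> * b * (G (w j) \<bullet> d j))"
      using A(4) [of j k] lt bX unfolding b_def by simp
    then have "b * (N j * (\<sigma> * (G (w j) \<bullet> q j))) < b * (N j * (G (w j + t *\<^sub>R d j) \<bullet> q j))"
      using t(3) unfolding dq [of j] by (simp add: algebra_simps)
    then have "\<sigma> * (G (w j) \<bullet> q j) \<le> G (w j + t *\<^sub>R d j) \<bullet> q j"
      using b(2) N(1) [of j] by (simp add: mult_less_cancel_left_pos)
    then show ?case
      unfolding u_def using t b by (intro someI [where P = "\<lambda>u. u \<in> {0..a j / \<beta>} \<and> w j + u *\<^sub>R d j \<in> X
      \<and> \<sigma> * (G (w j) \<bullet> q j) \<le> G (w j + u *\<^sub>R d j) \<bullet> q j"]) auto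
  qed
  \<comment> \<open>\<open>a j * N j\<close> tends to 0, not just \<open>a j\<close>; this controls
    the mean value points although \<open>d j\<close> may be unbounded.\<close>
  have "(\<lambda>j. u j *\<^sub>R d j) \<longlonglongrightarrow> 0"
  proof (rule Lim_null_comparison)
    show "\<forall>\<^sub>F j in sequentially. norm (u j *\<^sub>R d j) \<le> a j * N j / \<beta>"
      using u
    proof eventually_elim
      case (elim j)
      then have "u j * N j \<le> (a j / \<beta>) * N j"
        using N(1) [of j] by (intro mult_right_mono) auto
      then show ?case
        using elim by (simp add: N_def)
    qed
    show "(\<lambda>j. a j * N j / \<beta>) \<longlonglongrightarrow> 0"
      using tendsto_divide [OF aN tendsto_const, of \<beta>] par by simp
  qed
  then have wu: "(\<lambda>j. w j + u j *\<^sub>R d j) \<longlonglongrightarrow> z"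
    using tendsto_add [OF w(2), of "\<lambda>j. u j *\<^sub>R d j" 0] by simp
  have "(\<lambda>j. G (w j + u j *\<^sub>R d j) \<bullet> q j) \<longlonglongrightarrow> G z \<bullet> p"
    using u by (intro tendsto_inner q continuous_on_tendsto_compose [OF cont wu w(3)]) (auto elim: eventually_mono)
  moreover have "(\<lambda>j. \<sigma> * (G (w j) \<bullet> q j)) \<longlonglongrightarrow> \<sigma> * (G z \<bullet> p)"
    by (intro tendsto_intros g)
  ultimately have "\<sigma> * (G z \<bullet> p) \<le> G z \<bullet> p"
    using u by (intro tendsto_le [OF sequentially_bot]) (auto elim: eventually_mono)
  then show False
    using neg par by (simp add: mult_le_cancel_right1)
qed

section \<open>Subsequences\<close>

text \<open>Used to freeze the block set, or the offset within a period, along a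
  subsequence.\<close>

lemma infinite_pigeonhole_subsequence:
  fixes P :: "nat \<Rightarrow> bool"
  assumes "infinite {j. P j}" "finite C" "\<And>j. P j \<Longrightarrow> c j \<in> C"
  obtains r :: "nat \<Rightarrow> nat" and c0 where "strict_mono r" "\<And>j. P (r j)" "\<And>j. c (r j) = c0"
proof -
  have "finite (c ` {j. P j})"
    using assms(2,3) by (auto intro: finite_subset [of _ C])
  then obtain i where "infinite {j. P j \<and> c j = c i}"
    using pigeonhole_infinite [of "{j. P j}" c] assms(1) by auto
  then obtain r :: "nat \<Rightarrow> nat" where "strict_mono r" "\<And>j. r j \<in> {j. P j \<and> c j = c i}"
    using infinite_enumerate by blast
  then show ?thesis
    by (intro that [of r "c i"]) auto
qed

text \<open>Since \<open>r \<le> s r\<close>, the limit of the subsequence is a lower bound for all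
  of \<open>F\<close>, so \<open>F\<close> converges, necessarily to the same limit.\<close>

lemma decseq_tendsto_subsequence:
  fixes F :: "nat \<Rightarrow> real"
  assumes "decseq F" "strict_mono s" "(F \<circ> s) \<longlonglongrightarrow> L"
  shows "F \<longlonglongrightarrow> L"
proof -
  have "decseq (F \<circ> s)"
    using assms(1,2) by (simp add: decseq_def strict_mono_less_eq)
  then have "L \<le> F (s r)" for r
    using decseq_ge [OF _ assms(3), of r] by simp
  then have "L \<le> F r" for r
    using decseqD [OF assms(1) seq_suble [OF assms(2), of r]] order_trans by blast
  then obtain M where M: "F \<longlonglongrightarrow> M"
    using decseq_convergent [OF assms(1), of L] by blast
  then show ?thesis
    using LIMSEQ_unique [OF LIMSEQ_subseq_LIMSEQ [OF M assms(2)] assms(3)] by simp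
qed

section \<open>Feasibility and descent for a run of the algorithm\<close>

text \<open>
  Iterations are numbered from \<open>0\<close> here: \<open>d r\<close> and \<open>a r\<close> are the paper's \<open>d^(r+1)\<close> and
  \<open>\<alpha>^(r+1)\<close>, which lead from \<open>x r\<close> to \<open>x (Suc r)\<close> along the blocks in \<open>\<theta> (Suc r)\<close>.
\<close>

locale bsca_run =
  fixes blk :: "'N::finite \<Rightarrow> nat" and n :: nat and Xs :: "nat \<Rightarrow> (real ^ 'N) set"
    and X :: "(real ^ 'N) set" and f :: "real ^ 'N \<Rightarrow> real" and G :: "real ^ 'N \<Rightarrow> real ^ 'N"
    and \<theta> :: "nat \<Rightarrow> nat set" and h :: "nat set \<Rightarrow> real ^ 'N \<Rightarrow> real ^ 'N \<Rightarrow> real"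
    and \<sigma> \<beta> \<alpha>init :: real and x d :: "nat \<Rightarrow> real ^ 'N" and a :: "nat \<Rightarrow> real"
  assumes blocks: "range blk \<subseteq> {1..n}"
    and Xs: "\<And>i. i \<in> {1..n} \<Longrightarrow> closed (Xs i) \<and> convex (Xs i)"
    and X: "X = block_prod blk Xs {1..n}"
    and G_cont: "continuous_on X G"
    and G_deriv: "\<And>w. w \<in> X \<Longrightarrow> (f has_derivative (\<lambda>v. G w \<bullet> v)) (at w within X)"
    and \<theta>_subset: "\<And>r. \<theta> (Suc r) \<subseteq> {1..n}"
    and h_cont: "\<And>r. continuous_on (block_prod blk Xs (\<theta> (Suc r)) \<times> X) (\<lambda>(v, w). h (\<theta> (Suc r)) v w)"
    and h_convex: "\<And>r w. w \<in> X \<Longrightarrow>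
          strictly_convex_on (block_prod blk Xs (\<theta> (Suc r))) (\<lambda>v. h (\<theta> (Suc r)) v w)"
    and h_deriv: "\<And>r w e. \<lbrakk>w \<in> X; e \<in> block_space blk (\<theta> (Suc r));
            block_restrict blk (\<theta> (Suc r)) w + e \<in> block_prod blk Xs (\<theta> (Suc r))\<rbrakk> \<Longrightarrow>
          dir_deriv (\<lambda>v. h (\<theta> (Suc r)) v w) (block_restrict blk (\<theta> (Suc r)) w) e = dir_deriv f w e"
    and par: "0 < \<sigma>" "\<sigma> < 1" "0 < \<beta>" "\<beta> < 1" "0 < \<alpha>init"
    and start: "x 0 \<in> X"
    and d_space: "\<And>r. d r \<in> block_space blk (\<theta> (Suc r))"
    and d_min: "\<And>r. is_arg_min (\<lambda>v. h (\<theta> (Suc r)) v (x r)) (\<lambda>v. v \<in> block_prod blk Xs (\<theta> (Suc r)))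
          (block_restrict blk (\<theta> (Suc r)) (x r) + d r)"
    and armijo: "\<And>r. armijo_step f X \<sigma> \<beta> \<alpha>init (x r) (d r) (a r)"
    and step: "\<And>r. x (Suc r) = x r + a r *\<^sub>R d r"
begin

lemma convex_X: "convex X"
  unfolding X using Xs by (intro convex_block_prod) auto

lemma closed_X: "closed X"
  unfolding X using Xs by (intro closed_block_prod) auto

lemma closed_subprod: "closed (block_prod blk Xs (\<theta> (Suc r)))"
  using Xs \<theta>_subset by (intro closed_block_prod) blast

lemma restrict_in: "w \<in> X \<Longrightarrow> block_restrict blk (\<theta> (Suc r)) w \<in> block_prod blk Xs (\<theta> (Suc r))"
  using block_restrict_in_prod [OF _ \<theta>_subset] unfolding X .

lemma x_in: "x r \<in> X"
  using start armijo step by (cases r) (auto simp: armijo_step_def Let_def)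

lemma add_in:
  assumes "w \<in> X" "e \<in> block_space blk (\<theta> (Suc r))"
    and "block_restrict blk (\<theta> (Suc r)) w + e \<in> block_prod blk Xs (\<theta> (Suc r))"
  shows "w + e \<in> X"
proof -
  have "block_restrict blk (\<theta> (Suc r)) (w + e) \<in> block_prod blk Xs (\<theta> (Suc r))"
    using assms(3) by (simp add: block_restrict_add block_restrict_id [OF assms(2)])
  moreover have "(w + e) $ c = w $ c" if "blk c \<notin> \<theta> (Suc r)" for c
    using assms(2) that by (simp add: block_space_def)
  ultimately show ?thesis
    using block_prod_replace \<theta>_subset assms(1) unfolding X by blast
qed

lemma dir_deriv_h:
  assumes "w \<in> X" "e \<in> block_space blk (\<theta> (Suc r))"
    and "block_restrict blk (\<theta> (Suc r)) w + e \<in> block_prod blk Xs (\<theta> (Suc r))"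
  shows "dir_deriv (\<lambda>v. h (\<theta> (Suc r)) v w) (block_restrict blk (\<theta> (Suc r)) w) e = ereal (G w \<bullet> e)"
  using h_deriv [OF assms] dir_deriv_eq_inner [OF convex_X assms(1) add_in [OF assms] G_deriv] by simp

lemma y_in: "block_restrict blk (\<theta> (Suc r)) (x r) + d r \<in> block_prod blk Xs (\<theta> (Suc r))"
  using d_min by (simp add: is_arg_min_def)

lemma h_le:
  "v \<in> block_prod blk Xs (\<theta> (Suc r)) \<Longrightarrow>
    h (\<theta> (Suc r)) (block_restrict blk (\<theta> (Suc r)) (x r) + d r) (x r) \<le> h (\<theta> (Suc r)) v (x r)"
  using d_min [of r] by (auto simp: is_arg_min_def not_less)

lemma xd_in: "x r + d r \<in> X"
  using add_in [OF x_in d_space y_in] .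

text \<open>The current block is itself a candidate in the subproblem, so \<open>h\<close> does not
  increase along \<open>d r\<close>; by strict convexity its derivative, which is that of
  \<open>f\<close>, is negative unless \<open>d r = 0\<close>.\<close>

lemma grad_nonpos: "G (x r) \<bullet> d r \<le> 0"
proof (cases "d r = 0")
  case False
  from dir_deriv_neg [OF h_convex [OF x_in] restrict_in [OF x_in] y_in False h_le [OF restrict_in [OF x_in]]]
  show ?thesis
    unfolding dir_deriv_h [OF x_in d_space y_in] by simp
qed simp

lemmas armijoD = armijo_stepD [OF armijo dir_deriv_eq_inner [OF convex_X x_in xd_in G_deriv]]

lemma a_bounds: "0 < a r" "a r \<le> \<alpha>init"
proof -
  obtain m where "a r = \<alpha>init * \<beta> ^ m"
    using armijoD(1) by blast
  moreover have "\<beta> ^ m \<le> 1"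
    using par by (intro power_le_one) auto
  ultimately show "0 < a r" "a r \<le> \<alpha>init"
    using par by (auto simp: mult_left_le)
qed

lemma decseq_f: "decseq (\<lambda>r. f (x r))"
proof (rule decseq_SucI)
  fix r
  have "\<sigma> * a r * (G (x r) \<bullet> d r) \<le> 0"
    using par a_bounds(1) [of r] grad_nonpos [of r] by (intro mult_nonneg_nonpos) auto
  then show "f (x (Suc r)) \<le> f (x r)"
    using armijoD(3) [of r] unfolding step by linarith
qed

lemma continuous_f: "continuous_on X f"
  using G_deriv by (rule has_derivative_continuous_on)

section \<open>Behaviour along a convergent subsequence\<close>

context
  fixes z :: "real ^ 'N" and s :: "nat \<Rightarrow> nat"
  assumes s: "strict_mono s" and lim: "(\<lambda>j. x (s j)) \<longlonglongrightarrow> z"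
begin

lemma z_in: "z \<in> X"
  using closed_sequentially [OF closed_X _ lim] x_in by simp

text \<open>Convergence of \<open>f\<close> along the subsequence extends to the whole monotone
  sequence of values, so the decreases vanish along every subsequence.\<close>

lemma decrease_tendsto_0: "(\<lambda>r. f (x r) - f (x (Suc r))) \<longlonglongrightarrow> 0"
proof -
  have "((\<lambda>r. f (x r)) \<circ> s) \<longlonglongrightarrow> f z"
    using continuous_on_tendsto_compose [OF continuous_f lim z_in] x_in by (simp add: o_def)
  then have "(\<lambda>r. f (x r)) \<longlonglongrightarrow> f z"
    using decseq_tendsto_subsequence [OF decseq_f s] by blast
  from tendsto_diff [OF this LIMSEQ_Suc [OF this]] show ?thesis by simp
qed

lemma direction_tendsto_0: "(\<lambda>j. d (s j)) \<longlonglongrightarrow> 0"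
proof (rule ccontr)
  assume "\<not> ?thesis"
  then obtain \<delta> where \<delta>: "0 < \<delta>" "\<not> (\<forall>\<^sub>F j in sequentially. dist (d (s j)) 0 < \<delta>)"
    unfolding tendsto_iff by blast
  then have "infinite {j. \<delta> \<le> norm (d (s j))}"
    unfolding not_eventually frequently_cofinite [symmetric] cofinite_eq_sequentially
    by (simp add: not_less)
  \<comment> \<open>Only finitely many block sets exist, so one of them recurs along the large
    directions.\<close>
  then obtain r :: "nat \<Rightarrow> nat" and S where r: "strict_mono r" "\<And>j. \<delta> \<le> norm (d (s (r j)))" "\<And>j. \<theta> (Suc (s (r j))) = S"
    by (rule infinite_pigeonhole_subsequence [where C = "Pow {1..n}" and c = "\<lambda>j. \<theta> (Suc (s j))"])
       (use \<theta>_subset in auto)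
  have "d (s (r j)) \<noteq> 0" for j
    using \<delta>(1) r(2) [of j] by auto
  then have "d (s (r j)) /\<^sub>R norm (d (s (r j))) \<in> sphere 0 1" for j
    by simp
  then obtain p and q :: "nat \<Rightarrow> nat" where q: "strict_mono q"
      and p: "((\<lambda>j. d (s (r j)) /\<^sub>R norm (d (s (r j)))) \<circ> q) \<longlonglongrightarrow> p"
    using compact_sphere [of 0 1, unfolded compact_def, rule_format,
        of "\<lambda>j. d (s (r j)) /\<^sub>R norm (d (s (r j)))"] by blast
  define t where "t j = s (r (q j))" for j
  have t: "strict_mono t"
    unfolding t_def using s r(1) q by (simp add: strict_mono_def)
  have \<theta>t: "\<theta> (Suc (t j)) = S" for j
    using r(3) by (simp add: t_def)
  have lim_t: "(\<lambda>j. x (t j)) \<longlonglongrightarrow> z"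
    using LIMSEQ_subseq_LIMSEQ [OF lim, of "r \<circ> q"] strict_mono_o [OF r(1) q]
    by (simp add: t_def o_def)
  have p': "(\<lambda>j. d (t j) /\<^sub>R norm (d (t j))) \<longlonglongrightarrow> p"
    using p by (simp add: t_def o_def)
  have \<delta>t: "\<delta> \<le> norm (d (t j))" for j
    using r(2) by (simp add: t_def)
  have "0 \<le> G z \<bullet> p"
  proof (rule armijo_limit_direction [OF convex_X G_cont G_deriv par x_in lim_t z_in xd_in armijo _ \<delta>(1) \<delta>t p'])
    show "(\<lambda>j. f (x (t j)) - f (x (t j) + a (t j) *\<^sub>R d (t j))) \<longlonglongrightarrow> 0"
      using LIMSEQ_subseq_LIMSEQ [OF decrease_tendsto_0 t] by (simp add: o_def step)
  qed
  moreover have "G z \<bullet> p < 0"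
  proof -
    define t0 where "t0 = t 0"
    let ?S = "\<theta> (Suc t0)"
    have eqs: "\<theta> (Suc (t j)) = ?S" for j
      unfolding t0_def \<theta>t ..
    note L = dir_deriv_limit_neg [OF closed_subprod h_cont h_convex x_in lim_t z_in,
        where v = "\<lambda>j. block_restrict blk ?S (x (t j))" and l = "block_restrict blk ?S z"
          and e = "\<lambda>j. d (t j)" and \<delta> = \<delta> and p = p]
    have yt: "block_restrict blk ?S (x (t j)) + d (t j) \<in> block_prod blk Xs ?S" for j
      using y_in [of "t j"] unfolding eqs .
    have ht: "h ?S (block_restrict blk ?S (x (t j)) + d (t j)) (x (t j))
        \<le> h ?S (block_restrict blk ?S (x (t j))) (x (t j))" for j
      using h_le [OF restrict_in [OF x_in [of "t j"]], of "t j"] unfolding eqs .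
    have mem: "block_restrict blk ?S z + \<delta> *\<^sub>R p \<in> block_prod blk Xs ?S"
      by (rule L) (use restrict_in [OF x_in] tendsto_block_restrict [OF lim_t] yt ht \<delta>(1) \<delta>t p' in auto)
    have neg: "dir_deriv (\<lambda>v. h ?S v z) (block_restrict blk ?S z) (\<delta> *\<^sub>R p) < 0"
      by (rule L) (use restrict_in [OF x_in] tendsto_block_restrict [OF lim_t] yt ht \<delta>(1) \<delta>t p' in auto)
    have "\<delta> *\<^sub>R p \<in> block_space blk ?S"
      using mem by (auto simp: block_prod_def block_space_def)
    then have "ereal (G z \<bullet> (\<delta> *\<^sub>R p)) < 0"
      using neg dir_deriv_h [OF z_in _ mem] by simp
    then show ?thesis
      using \<delta>(1) by (simp add: mult_less_0_iff)
  qed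
  ultimately show False by simp
qed

text \<open>Step sizes are at most \<alpha>init, so the vanishing directions give vanishing
  displacements.\<close>

lemma next_tendsto: "(\<lambda>j. x (Suc (s j))) \<longlonglongrightarrow> z"
proof -
  have "(\<lambda>j. a (s j) *\<^sub>R d (s j)) \<longlonglongrightarrow> 0"
  proof (rule Lim_null_comparison)
    show "\<forall>\<^sub>F j in sequentially. norm (a (s j) *\<^sub>R d (s j)) \<le> \<alpha>init * norm (d (s j))"
      using a_bounds by (intro always_eventually allI) (auto simp: abs_of_pos intro: mult_right_mono)
    show "(\<lambda>j. \<alpha>init * norm (d (s j))) \<longlonglongrightarrow> 0"
      using tendsto_mult_right_zero [OF tendsto_norm_zero [OF direction_tendsto_0]] .
  qed
  from tendsto_add [OF lim this] show ?thesis
    by (simp add: step)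
qed

text \<open>Along the iterations that use one fixed block set containing \<open>k\<close>,
  minimality of the subproblem solutions survives in the limit. The \<open>k\<close>-part of a
  feasible direction is feasible in that subproblem because the constraint set is a product.\<close>

lemma block_grad_nonneg:
  assumes inf: "infinite {j. k \<in> \<theta> (Suc (s j))}" and e: "z + e \<in> X"
  shows "0 \<le> G z \<bullet> block_restrict blk {k} e"
proof -
  obtain r :: "nat \<Rightarrow> nat" and S where r: "strict_mono r" "\<And>j. k \<in> \<theta> (Suc (s (r j)))" "\<And>j. \<theta> (Suc (s (r j))) = S"
    by (rule infinite_pigeonhole_subsequence [OF inf, of "Pow {1..n}" "\<lambda>j. \<theta> (Suc (s j))"])
       (use \<theta>_subset in auto)
  define t where "t = s (r 0)"
  have eqs: "\<theta> (Suc (s (r j))) = \<theta> (Suc t)" for j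
    using r(3) by (simp add: t_def)
  have k: "k \<in> \<theta> (Suc t)"
    using r(2) by (simp add: t_def)
  let ?S = "\<theta> (Suc t)"
  let ?z = "block_restrict blk ?S z" and ?e = "block_restrict blk {k} e"
  have lim_r: "(\<lambda>j. x (s (r j))) \<longlonglongrightarrow> z" and d_r: "(\<lambda>j. d (s (r j))) \<longlonglongrightarrow> 0"
    using LIMSEQ_subseq_LIMSEQ [OF _ r(1)] lim direction_tendsto_0 by (fastforce simp: o_def)+
  \<comment> \<open>Vanishing directions make the minimisers converge to the blocks of
    \<open>z\<close>; joint continuity of \<open>h\<close> then allows the limit against each fixed
    competitor \<open>v\<close>.\<close>
  have min: "h ?S ?z z \<le> h ?S v z" if v: "v \<in> block_prod blk Xs ?S" for v
  proof (rule LIMSEQ_le)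
    have "(\<lambda>j. block_restrict blk ?S (x (s (r j))) + d (s (r j))) \<longlonglongrightarrow> ?z"
      using tendsto_add [OF tendsto_block_restrict [OF lim_r] d_r] by simp
    from continuous_on_tendsto_compose [OF h_cont [of t] tendsto_Pair [OF this lim_r]]
    show "(\<lambda>j. h ?S (block_restrict blk ?S (x (s (r j))) + d (s (r j))) (x (s (r j)))) \<longlonglongrightarrow> h ?S ?z z"
      using restrict_in z_in x_in y_in [of "s (r _)"] unfolding eqs by simp
    from continuous_on_tendsto_compose [OF h_cont [of t] tendsto_Pair [OF tendsto_const [of v] lim_r]]
    show "(\<lambda>j. h ?S v (x (s (r j)))) \<longlonglongrightarrow> h ?S v z"
      using v z_in x_in by simp
    show "\<exists>N. \<forall>j\<ge>N. h ?S (block_restrict blk ?S (x (s (r j))) + d (s (r j))) (x (s (r j)))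
        \<le> h ?S v (x (s (r j)))"
      using h_le [of v "s (r _)"] v unfolding eqs by blast
  qed
  have mem: "?z + ?e \<in> block_prod blk Xs ?S"
  proof (rule block_prod_replace)
    show "?z \<in> block_prod blk Xs ?S"
      by (rule restrict_in [OF z_in])
    have "block_restrict blk {k} (z + e) \<in> block_prod blk Xs {k}"
      using e k \<theta>_subset unfolding X by (intro block_restrict_in_prod [where R = "{1..n}"]) blast+
    also have "block_restrict blk {k} (z + e) = block_restrict blk {k} (?z + ?e)"
      using k by (auto simp: vec_eq_iff)
    finally show "block_restrict blk {k} (?z + ?e) \<in> block_prod blk Xs {k}" .
  qed (use k in auto)
  have "0 \<le> dir_deriv (\<lambda>v. h ?S v z) ?z ?e"
  proof (rule dir_deriv_nonneg_at_min)
    fix u :: real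
    assume "0 < u" "u < 1"
    then show "h ?S ?z z \<le> h ?S (?z + u *\<^sub>R ?e) z"
      using h_convex [OF z_in] mem restrict_in [OF z_in]
      by (intro min convex_mem_segment) (auto simp: strictly_convex_on_def)
  qed
  also have "\<dots> = ereal (G z \<bullet> ?e)"
    using k by (intro dir_deriv_h [OF z_in _ mem]) (auto simp: block_space_def)
  finally show ?thesis by simp
qed

end

section \<open>Stationarity of limit points\<close>

text \<open>Each shifted index sequence is again strictly increasing with limit \<open>z\<close>, so
  the one-step result can be iterated.\<close>

lemma shift_tendsto:
  assumes "strict_mono s" "(\<lambda>j. x (s j)) \<longlonglongrightarrow> z"
  shows "(\<lambda>j. x (s j + i)) \<longlonglongrightarrow> z"
proof (induction i)
  case (Suc i)
  have "strict_mono (\<lambda>j. s j + i)"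
    using assms(1) by (simp add: strict_mono_def)
  from next_tendsto [OF this Suc] show ?case by simp
qed (use assms in simp)

lemma limit_stationary:
  assumes s: "strict_mono s" "(\<lambda>j. x (s j)) \<longlonglongrightarrow> z"
    and cyclic: "\<And>r. (\<Union>i\<in>{1..T}. \<theta> (r + i)) = {1..n}"
  shows "stationary f X z"
  unfolding stationary_def
proof (intro conjI allI impI)
  show z: "z \<in> X"
    using z_in [OF s] .
  fix e
  assume e: "z + e \<in> X"
  have "0 \<le> G z \<bullet> block_restrict blk {k} e" if k: "k \<in> {1..n}" for k
  proof -
    have "\<exists>i. i < T \<and> k \<in> \<theta> (Suc (s j + i))" for j
    proof -
      obtain i where "i \<in> {1..T}" "k \<in> \<theta> (s j + i)"
        using k cyclic [of "s j"] by blast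
      then show ?thesis
        \<comment> \<open>The cyclic rule has offsets \<open>1..T\<close>, whereas
          \<open>Suc\<close> already contributes one; hence \<open>i - 1\<close>, which lies below
          \<open>T\<close>.\<close>
        by (intro exI [of _ "i - 1"]) auto
    qed
    then obtain c where c: "\<And>j. c j < T" "\<And>j. k \<in> \<theta> (Suc (s j + c j))"
      by metis
    \<comment> \<open>The offset depends on \<open>j\<close>; freezing it makes the convergence for
      fixed shifts applicable.\<close>
    obtain r :: "nat \<Rightarrow> nat" and i where r: "strict_mono r" "\<And>j. c (r j) = i"
      by (rule infinite_pigeonhole_subsequence [of "\<lambda>_. True" "{..<T}" c]) (use c(1) in auto)
    have mono: "strict_mono (\<lambda>j. s (r j) + i)"
      using s(1) r(1) by (simp add: strict_mono_def)
    have "(\<lambda>j. x (s (r j) + i)) \<longlonglongrightarrow> z"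
      using LIMSEQ_subseq_LIMSEQ [OF shift_tendsto [OF s, of i] r(1)] by (simp add: o_def)
    moreover have "{j. k \<in> \<theta> (Suc (s (r j) + i))} = UNIV"
      using c(2) [of "r _"] r(2) by auto
    ultimately show ?thesis
      using block_grad_nonneg [OF mono _ _ e, of k] by simp
  qed
  \<comment> \<open>Linearity of the gradient form lets the blockwise inequalities add up to the
    full direction \<open>e\<close>.\<close>
  then have "0 \<le> (\<Sum>k\<in>{1..n}. G z \<bullet> block_restrict blk {k} e)"
    by (intro sum_nonneg)
  also have "\<dots> = G z \<bullet> e"
    by (simp only: inner_sum_right [symmetric] sum_block_restrict [OF blocks finite_atLeastAtMost])
  finally show "0 \<le> dir_deriv f z e"
    using dir_deriv_eq_inner [OF convex_X z e G_deriv] by simp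
qed

end

section \<open>Passage from the algorithm's definition to a run\<close>

theorem corollary3:
  fixes blk :: "'N::finite \<Rightarrow> nat"
    and n T :: nat
    and Xs :: "nat \<Rightarrow> (real ^ 'N) set"
    and X :: "(real ^ 'N) set"
    and f :: "real ^ 'N \<Rightarrow> real"
    and \<theta> :: "nat \<Rightarrow> nat set"
    and h :: "nat set \<Rightarrow> real ^ 'N \<Rightarrow> real ^ 'N \<Rightarrow> real"
    and \<sigma> \<beta> \<alpha>init :: real
    and x :: "nat \<Rightarrow> real ^ 'N"
    and z :: "real ^ 'N"
  assumes blocks: "range blk \<subseteq> {1..n}"
    and Xs: "\<And>i. i \<in> {1..n} \<Longrightarrow> Xs i \<subseteq> block_space blk {i} \<and> closed (Xs i) \<and> convex (Xs i)"
    and X: "X = block_prod blk Xs {1..n}"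
    and f: "C1_on X f"
    and T: "T \<ge> 1"
    and cyclic: "essentially_cyclic n T \<theta>"
    and h_cont: "\<And>S. S \<in> \<theta> ` {1..} \<Longrightarrow>
          continuous_on (block_prod blk Xs S \<times> X) (\<lambda>(v, w). h S v w)"
    and h_convex: "\<And>S w. S \<in> \<theta> ` {1..} \<Longrightarrow> w \<in> X \<Longrightarrow>
          strictly_convex_on (block_prod blk Xs S) (\<lambda>v. h S v w)"
    and h_deriv: "\<And>S w d. S \<in> \<theta> ` {1..} \<Longrightarrow> w \<in> X \<Longrightarrow> d \<in> block_space blk S \<Longrightarrow>
          block_restrict blk S w + block_restrict blk S d \<in> block_prod blk Xs S \<Longrightarrow>
          dir_deriv (\<lambda>v. h S v w) (block_restrict blk S w) (block_restrict blk S d)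
            = dir_deriv f w d"
    and sigma: "0 < \<sigma>" "\<sigma> < 1"
    and beta: "0 < \<beta>" "\<beta> < 1"
    and alpha: "\<alpha>init > 0"
    and seq: "bsca_sequence blk n Xs f h \<theta> \<sigma> \<beta> \<alpha>init x"
    and limit: "limit_point_of x z"
  shows "stationary f X z"
proof -
  from f obtain G where G: "continuous_on X G"
      "\<And>w. w \<in> X \<Longrightarrow> (f has_derivative (\<lambda>v. G w \<bullet> v)) (at w within X)"
    unfolding C1_on_def by blast
  have x0: "x 0 \<in> X"
    using seq unfolding bsca_sequence_def X by blast
  \<comment> \<open>Replacing \<open>r\<close> by \<open>Suc r\<close> removes the condition
    \<open>r \<ge> 1\<close> and the predecessor \<open>r - 1\<close>, so \<open>y\<close> and
    \<open>a\<close> can be chosen as sequences indexed from 0.\<close>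
  have "\<forall>r. \<exists>y \<alpha>.
        is_arg_min (\<lambda>v. h (\<theta> (Suc r)) v (x r)) (\<lambda>v. v \<in> block_prod blk Xs (\<theta> (Suc r)))
          (block_restrict blk (\<theta> (Suc r)) y) \<and>
        (\<forall>c. blk c \<notin> \<theta> (Suc r) \<longrightarrow> y $ c = x r $ c) \<and>
        armijo_step f X \<sigma> \<beta> \<alpha>init (x r) (y - x r) \<alpha> \<and>
        x (Suc r) = x r + \<alpha> *\<^sub>R (y - x r)"
  proof
    fix r
    show "\<exists>y \<alpha>.
        is_arg_min (\<lambda>v. h (\<theta> (Suc r)) v (x r)) (\<lambda>v. v \<in> block_prod blk Xs (\<theta> (Suc r)))
          (block_restrict blk (\<theta> (Suc r)) y) \<and>
        (\<forall>c. blk c \<notin> \<theta> (Suc r) \<longrightarrow> y $ c = x r $ c) \<and>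
        armijo_step f X \<sigma> \<beta> \<alpha>init (x r) (y - x r) \<alpha> \<and>
        x (Suc r) = x r + \<alpha> *\<^sub>R (y - x r)"
      using conjunct2 [OF seq [unfolded bsca_sequence_def], rule_format, of "Suc r"]
      unfolding X by simp
  qed
  then obtain y a where y:
      "\<And>r. is_arg_min (\<lambda>v. h (\<theta> (Suc r)) v (x r)) (\<lambda>v. v \<in> block_prod blk Xs (\<theta> (Suc r)))
          (block_restrict blk (\<theta> (Suc r)) (y r))"
      "\<And>r c. blk c \<notin> \<theta> (Suc r) \<Longrightarrow> y r $ c = x r $ c"
      "\<And>r. armijo_step f X \<sigma> \<beta> \<alpha>init (x r) (y r - x r) (a r)"
      "\<And>r. x (Suc r) = x r + a r *\<^sub>R (y r - x r)"
    by metis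
  have d: "y r - x r \<in> block_space blk (\<theta> (Suc r))" for r
    using y(2) by (auto simp: block_space_def)
  \<comment> \<open>Since \<open>y r\<close> agrees with \<open>x r\<close> outside the updated
    blocks, the full difference is also the difference of the restricted vectors.\<close>
  have arg: "block_restrict blk (\<theta> (Suc r)) (y r) = block_restrict blk (\<theta> (Suc r)) (x r) + (y r - x r)" for r
    using block_restrict_id [OF d [of r]] by (simp add: block_restrict_diff algebra_simps)
  have mem: "\<theta> (Suc r) \<in> \<theta> ` {1..}" for r
    by auto
  interpret bsca_run blk n Xs X f G \<theta> h \<sigma> \<beta> \<alpha>init x "\<lambda>r. y r - x r" a
  proof
    show "\<theta> (Suc r) \<subseteq> {1..n}" for r
      using cyclic unfolding essentially_cyclic_def by simp
    show "dir_deriv (\<lambda>v. h (\<theta> (Suc r)) v w) (block_restrict blk (\<theta> (Suc r)) w) e = dir_deriv f w e"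
      if "w \<in> X" "e \<in> block_space blk (\<theta> (Suc r))"
        "block_restrict blk (\<theta> (Suc r)) w + e \<in> block_prod blk Xs (\<theta> (Suc r))" for r w e
      using h_deriv [OF mem that(1,2)] that(3) by (simp add: block_restrict_id [OF that(2)])
    show "closed (Xs i) \<and> convex (Xs i)" if "i \<in> {1..n}" for i
      using Xs that by blast
    show "is_arg_min (\<lambda>v. h (\<theta> (Suc r)) v (x r)) (\<lambda>v. v \<in> block_prod blk Xs (\<theta> (Suc r)))
          (block_restrict blk (\<theta> (Suc r)) (x r) + (y r - x r))" for r
      using y(1) [of r] unfolding arg .
    show "X = block_prod blk Xs {1..n}" by (rule X)
  qed (rule blocks G sigma beta alpha x0 d y(3,4) h_cont h_convex mem | assumption)+
  show ?thesis
    using limit cyclic limit_stationary unfolding limit_point_of_def essentially_cyclic_def o_def by blast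
qed

end
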